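(* Fix $\varepsilon>0$. There is a constant $C=C(\varepsilon)$ such that every Latin square of order $n$ has a minimal cover of size at least $3n-C n^{1/2+\varepsilon}$; that is, every Latin square of order $n$ has a minimal cover of size $3n-O(n^{1/2+\varepsilon})$.
   Context: A Latin square of order $n$ is an $n\times n$ array on $n$ symbols in which each symbol occurs once in each row and each column; its entries are the triples $(i,j,L_{ij})$. A line is the set of all entries in a given row, in a given column, or with a given symbol. A cover is a set of entries meeting every line. A cover $\mathscr{C}$ is minimal if for every entry $\mathbf{e}\in\mathscr{C}$ the set $\mathscr{C}\setminus\{\mathbf{e}\}$ is not a cover. *)

theory Defs
  imports Complex_Main
begin

text \<open>Rows and columns are indexed by \<open>{..<n}\<close>; the values of \<open>L\<close> outside
  \<open>{..<n} \<times> {..<n}\<close> are irrelevant. The symbol set \<open>S\<close> is an arbitrary set of \<open>n\<close> symbols.\<close>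

definition latin_square :: "nat \<Rightarrow> 's set \<Rightarrow> (nat \<Rightarrow> nat \<Rightarrow> 's) \<Rightarrow> bool" where
  "latin_square n S L \<longleftrightarrow>
     finite S \<and> card S = n \<and>
     (\<forall>i<n. \<forall>j<n. L i j \<in> S) \<and>
     (\<forall>i<n. \<forall>s\<in>S. \<exists>!j. j < n \<and> L i j = s) \<and>
     (\<forall>j<n. \<forall>s\<in>S. \<exists>!i. i < n \<and> L i j = s)"

definition entries :: "nat \<Rightarrow> (nat \<Rightarrow> nat \<Rightarrow> 's) \<Rightarrow> (nat \<times> nat \<times> 's) set" where
  "entries n L = {(i, j, L i j) | i j. i < n \<and> j < n}"

definition row_line :: "nat \<Rightarrow> (nat \<Rightarrow> nat \<Rightarrow> 's) \<Rightarrow> nat \<Rightarrow> (nat \<times> nat \<times> 's) set" where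
  "row_line n L i = {e \<in> entries n L. fst e = i}"

definition col_line :: "nat \<Rightarrow> (nat \<Rightarrow> nat \<Rightarrow> 's) \<Rightarrow> nat \<Rightarrow> (nat \<times> nat \<times> 's) set" where
  "col_line n L j = {e \<in> entries n L. fst (snd e) = j}"

definition sym_line :: "nat \<Rightarrow> (nat \<Rightarrow> nat \<Rightarrow> 's) \<Rightarrow> 's \<Rightarrow> (nat \<times> nat \<times> 's) set" where
  "sym_line n L s = {e \<in> entries n L. snd (snd e) = s}"

definition lines :: "nat \<Rightarrow> 's set \<Rightarrow> (nat \<Rightarrow> nat \<Rightarrow> 's) \<Rightarrow> (nat \<times> nat \<times> 's) set set" where
  "lines n S L = row_line n L ` {..<n} \<union> col_line n L ` {..<n} \<union> sym_line n L ` S"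

definition is_cover ::
  "nat \<Rightarrow> 's set \<Rightarrow> (nat \<Rightarrow> nat \<Rightarrow> 's) \<Rightarrow> (nat \<times> nat \<times> 's) set \<Rightarrow> bool" where
  "is_cover n S L K \<longleftrightarrow> K \<subseteq> entries n L \<and> (\<forall>l\<in>lines n S L. K \<inter> l \<noteq> {})"

definition is_minimal_cover ::
  "nat \<Rightarrow> 's set \<Rightarrow> (nat \<Rightarrow> nat \<Rightarrow> 's) \<Rightarrow> (nat \<times> nat \<times> 's) set \<Rightarrow> bool" where
  "is_minimal_cover n S L K \<longleftrightarrow>
     is_cover n S L K \<and> (\<forall>e\<in>K. \<not> is_cover n S L (K - {e}))"

end

theory Submission
  imports Defs
begin

text \<open>Suppose \<open>R\<close>, \<open>C\<close>, \<open>T\<close> are nonempty sets of rows, columns and symbols such that every line meets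
  an entry whose two other lines belong to them. Then the entries having at most one line outside
  \<open>R \<union> C \<union> T\<close> form a cover, and any minimal cover \<open>K\<close> inside it has at least
  \<open>3n - |R| - |C| - |T|\<close> entries, since each entry of \<open>K\<close> meets at most one of the lines
  outside. Such sets of size \<open>O(sqrt n * ln n)\<close> are obtained by taking \<open>C\<close> to be any set of about
  \<open>sqrt n\<close> columns and choosing first \<open>T\<close> and then \<open>R\<close> as greedy hitting sets.\<close>

section \<open>Greedy hitting sets\<close>

text \<open>Double counting of the pairs \<open>(i, v)\<close> with \<open>v \<in> A i\<close>:
  there are at least \<open>card J * m\<close> of them, so some \<open>v\<close> has at least the
  average share. The bound is multiplied out to avoid division in \<open>nat\<close>.\<close>

lemma finite_pigeonhole_incidence:
  fixes A :: "'i \<Rightarrow> 'v set"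
  assumes "finite V" "V \<noteq> {}" "finite J"
    and "\<And>i. i \<in> J \<Longrightarrow> A i \<subseteq> V" "\<And>i. i \<in> J \<Longrightarrow> m \<le> card (A i)"
  obtains v where "v \<in> V" "card J * m \<le> card V * card {i\<in>J. v \<in> A i}"
proof (rule ccontr)
  assume "\<not> thesis"
  with that have less: "card V * card {i\<in>J. v \<in> A i} < card J * m" if "v \<in> V" for v
    using that not_le by blast
  have "card J * m = (\<Sum>i\<in>J. m)"
    by simp
  also have "\<dots> \<le> (\<Sum>i\<in>J. card {v\<in>V. v \<in> A i})"
  proof (rule sum_mono)
    fix i assume "i \<in> J"
    moreover from this have "{v\<in>V. v \<in> A i} = A i"
      using assms(4) by auto
    ultimately show "m \<le> card {v\<in>V. v \<in> A i}"
      using assms(5) by simp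
  qed
  also have "\<dots> = (\<Sum>v\<in>V. card {i\<in>J. v \<in> A i})"
    by (rule sum_multicount_gen) (use assms in auto)
  finally have "card V * (card J * m) \<le> (\<Sum>v\<in>V. card V * card {i\<in>J. v \<in> A i})"
    by (simp add: sum_distrib_left[symmetric])
  also have "\<dots> < (\<Sum>v\<in>V. card J * m)"
    by (rule sum_strict_mono) (use assms less in auto)
  finally show False
    by simp
qed

text \<open>The pigeonhole element lies in at least a fraction \<open>m / card V\<close> of the sets
  not yet hit, so adding it multiplies their number by at most
  \<open>1 - m / card V \<le> exp (- (m / card V))\<close>.\<close>

lemma greedy_hitting_set:
  fixes A :: "'i \<Rightarrow> 'v set"
  assumes "finite V" "V \<noteq> {}" "finite I"
    and "\<And>i. i \<in> I \<Longrightarrow> A i \<subseteq> V" "\<And>i. i \<in> I \<Longrightarrow> m \<le> card (A i)"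
  shows "\<exists>T\<subseteq>V. card T \<le> t \<and>
    real (card {i\<in>I. A i \<inter> T = {}}) \<le> card I * exp (- (real m / card V) * t)"
proof (induction t)
  case 0
  show ?case by (rule exI[of _ "{}"]) simp
next
  case (Suc t)
  then obtain T where T: "T \<subseteq> V" "card T \<le> t"
    and le: "real (card {i\<in>I. A i \<inter> T = {}}) \<le> card I * exp (- (real m / card V) * t)"
    by blast
  define J where "J = {i\<in>I. A i \<inter> T = {}}"
  have "finite J" using assms(3) by (simp add: J_def)
  obtain v where v: "v \<in> V" "card J * m \<le> card V * card {i\<in>J. v \<in> A i}"
    using finite_pigeonhole_incidence[OF assms(1,2) \<open>finite J\<close>, of A m] assms(4,5)
    unfolding J_def by blast
  have V: "0 < real (card V)"
    using assms by (simp add: card_gt_0_iff)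
  have "real (card J) * m \<le> card V * card {i\<in>J. v \<in> A i}"
    using v(2) by (metis of_nat_le_iff of_nat_mult)
  then have "card J * (real m / card V) \<le> card {i\<in>J. v \<in> A i}"
    using V by (simp add: field_simps)
  moreover have "{i\<in>I. A i \<inter> insert v T = {}} = J - {i\<in>J. v \<in> A i}"
    by (auto simp: J_def)
  then have "card {i\<in>I. A i \<inter> insert v T = {}} = card J - card {i\<in>J. v \<in> A i}"
    using \<open>finite J\<close> by (simp add: card_Diff_subset)
  moreover have "card {i\<in>J. v \<in> A i} \<le> card J"
    using \<open>finite J\<close> by (simp add: card_mono)
  ultimately have "real (card {i\<in>I. A i \<inter> insert v T = {}}) \<le> card J * (1 - real m / card V)"
    by (simp add: of_nat_diff algebra_simps)
  also have "\<dots> \<le> card J * exp (- (real m / card V))"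
    using exp_ge_add_one_self[of "- (real m / card V)"] by (intro mult_left_mono) auto
  also have "\<dots> \<le> (card I * exp (- (real m / card V) * t)) * exp (- (real m / card V))"
    using le by (intro mult_right_mono) (auto simp: J_def)
  also have "\<dots> = card I * exp (- (real m / card V) * Suc t)"
    by (simp add: exp_add[symmetric] algebra_simps add_divide_distrib)
  finally have "real (card {i\<in>I. A i \<inter> insert v T = {}}) \<le> \<dots>" .
  \<comment> \<open>Only an upper bound on the size is kept, because \<open>v\<close> may already
    lie in \<open>T\<close>, for instance when no set is left to hit.\<close>
  moreover have "card (insert v T) \<le> Suc t"
    using T(2) by (metis Suc_le_mono card_insert_if finite_subset[OF T(1) assms(1)] le_SucI)
  ultimately show ?case
    using T(1) v(1) by (intro exI[of _ "insert v T"]) auto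
qed

text \<open>After enough greedy steps the bound on the number of sets missed drops below 1; being a
  natural number, it is then 0.\<close>

lemma hitting_set:
  fixes A :: "'i \<Rightarrow> 'v set"
  assumes "finite V" "finite I" "I \<noteq> {}" "0 < m"
    and A: "\<And>i. i \<in> I \<Longrightarrow> A i \<subseteq> V" "\<And>i. i \<in> I \<Longrightarrow> m \<le> card (A i)"
  obtains T where "T \<subseteq> V" "\<And>i. i \<in> I \<Longrightarrow> A i \<inter> T \<noteq> {}"
    "real (card T) \<le> card V / m * ln (card I) + 1"
proof -
  obtain i where "i \<in> I" using assms(3) by blast
  with A assms(4) have "V \<noteq> {}" by fastforce
  with assms(1) have V: "0 < real (card V)" by (simp add: card_gt_0_iff)
  have I: "1 \<le> card I" using assms(2,3) by (simp add: Suc_le_eq card_gt_0_iff)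
  define x where "x = card V / m * ln (card I)"
  \<comment> \<open>\<open>x\<close> is where the greedy bound equals exactly 1. Going strictly
    beyond \<open>x\<close> makes it less than 1 and costs the summand 1 in the conclusion.\<close>
  define t where "t = nat \<lfloor>x\<rfloor> + 1"
  have "0 \<le> x" using I by (simp add: x_def)
  then have t: "x < t" "real t \<le> x + 1" unfolding t_def by linarith+
  have "\<exists>T\<subseteq>V. card T \<le> t \<and>
    real (card {i\<in>I. A i \<inter> T = {}}) \<le> card I * exp (- (real m / card V) * t)"
    by (rule greedy_hitting_set[OF assms(1) \<open>V \<noteq> {}\<close> assms(2) A])
  then obtain T where T: "T \<subseteq> V" "card T \<le> t"
    "real (card {i\<in>I. A i \<inter> T = {}}) \<le> card I * exp (- (real m / card V) * t)"
    by (elim exE conjE)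
  have "ln (card I) = real m / card V * x"
    using V assms(4) by (simp add: x_def)
  also have "\<dots> < real m / card V * t"
    using V assms(4) t(1) by (intro mult_strict_left_mono) auto
  finally have "card I < exp (real m / card V * t)"
    using I by (metis exp_less_mono exp_ln of_nat_0_less_iff less_le_trans zero_less_one)
  then have "card I * exp (- (real m / card V) * t) < 1"
    by (simp add: exp_minus field_simps)
  with T(3) have "card {i\<in>I. A i \<inter> T = {}} = 0" by linarith
  then have "{i\<in>I. A i \<inter> T = {}} = {}" using assms(2) by simp
  moreover have "real (card T) \<le> x + 1" using T(2) t(2) by linarith
  ultimately show thesis using that T(1) unfolding x_def by blast
qed

section \<open>Minimal covers and a lower bound on their size\<close>

lemma is_cover_iff:
  "is_cover n S L K \<longleftrightarrow> K \<subseteq> entries n L \<and> (\<forall>i<n. \<exists>e\<in>K. fst e = i) \<and>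
     (\<forall>j<n. \<exists>e\<in>K. fst (snd e) = j) \<and> (\<forall>s\<in>S. \<exists>e\<in>K. snd (snd e) = s)"
proof (cases "K \<subseteq> entries n L")
  case True
  then have "K \<inter> row_line n L i \<noteq> {} \<longleftrightarrow> (\<exists>e\<in>K. fst e = i)"
    "K \<inter> col_line n L j \<noteq> {} \<longleftrightarrow> (\<exists>e\<in>K. fst (snd e) = j)"
    "K \<inter> sym_line n L s \<noteq> {} \<longleftrightarrow> (\<exists>e\<in>K. snd (snd e) = s)" for i j s
    unfolding row_line_def col_line_def sym_line_def by blast+
  with True show ?thesis
    unfolding is_cover_def lines_def ball_Un ball_simps by (simp add: Ball_def)
qed (simp add: is_cover_def)

lemma finite_entries: "finite (entries n L)"
proof -
  have "entries n L = (\<lambda>(i, j). (i, j, L i j)) ` ({..<n} \<times> {..<n})"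
    by (auto simp: entries_def)
  then show ?thesis by simp
qed

text \<open>There are finitely many covers inside \<open>E\<close>, so one of them is minimal under
  inclusion; deleting an entry would give a smaller one.\<close>

lemma minimal_subcover:
  assumes "is_cover n S L E"
  obtains K where "K \<subseteq> E" "is_minimal_cover n S L K"
proof -
  have "finite E"
    using assms finite_entries finite_subset unfolding is_cover_def by metis
  then have "finite {K. K \<subseteq> E \<and> is_cover n S L K}"
    by simp
  from finite_has_minimal2[OF this, of E] assms obtain K where K: "K \<subseteq> E" "is_cover n S L K"
    and min: "\<forall>K'\<in>{K. K \<subseteq> E \<and> is_cover n S L K}. K' \<subseteq> K \<longrightarrow> K = K'"
    unfolding mem_Collect_eq by blast
  have "\<not> is_cover n S L (K - {e})" if "e \<in> K" for e
    using min K(1) that by blast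
  with K(2) have "is_minimal_cover n S L K"
    by (simp add: is_minimal_cover_def)
  with K(1) that show thesis by blast
qed

lemma card_cover_ge:
  assumes "is_cover n S L K" "finite S" "card S = n" "finite R" "finite C" "finite T"
    and K: "\<And>i j s. (i, j, s) \<in> K \<Longrightarrow> i \<in> R \<and> j \<in> C \<or> i \<in> R \<and> s \<in> T \<or> j \<in> C \<and> s \<in> T"
  shows "3 * n \<le> card K + card R + card C + card T"
proof -
  have fin: "finite K"
    using assms(1) finite_entries finite_subset unfolding is_cover_def by metis
  \<comment> \<open>The same count serves rows, columns and symbols, with \<open>f\<close> the
    coordinate: an element of \<open>X\<close> outside \<open>Y\<close> needs an entry of its own in
    \<open>K\<close>.\<close>
  have bound: "card X \<le> card Y + card {e\<in>K. f e \<notin> Y}"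
    if "finite Y" "\<forall>x\<in>X. \<exists>e\<in>K. f e = x" for X Y and f :: "_ \<Rightarrow> 'b"
  proof -
    have "X \<subseteq> Y \<union> f ` {e\<in>K. f e \<notin> Y}"
      using that(2) by force
    then have "card X \<le> card (Y \<union> f ` {e\<in>K. f e \<notin> Y})"
      using that(1) fin by (intro card_mono) auto
    also have "\<dots> \<le> card Y + card (f ` {e\<in>K. f e \<notin> Y})"
      by (rule card_Un_le)
    also have "\<dots> \<le> card Y + card {e\<in>K. f e \<notin> Y}"
      using fin by (simp add: card_image_le)
    finally show ?thesis .
  qed
  let ?R = "{e\<in>K. fst e \<notin> R}" and ?C = "{e\<in>K. fst (snd e) \<notin> C}"
    and ?T = "{e\<in>K. snd (snd e) \<notin> T}"
  have "n \<le> card R + card ?R" "n \<le> card C + card ?C" "n \<le> card T + card ?T"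
    using bound[of R "{..<n}" fst] bound[of C "{..<n}" "fst \<circ> snd"] bound[of T S "snd \<circ> snd"]
      assms(1-6) unfolding is_cover_iff by simp_all
  moreover have "card ?R + card ?C + card ?T = card (?R \<union> ?C \<union> ?T)"
  proof -
    \<comment> \<open>An entry in two of these sets would have two lines outside the chosen ones,
      which \<open>K\<close> excludes.\<close>
    have "?R \<inter> ?C = {}" "(?R \<union> ?C) \<inter> ?T = {}"
      using K by force+
    then show ?thesis
      using fin by (simp add: card_Un_disjoint)
  qed
  moreover have "card (?R \<union> ?C \<union> ?T) \<le> card K"
    using fin by (intro card_mono) auto
  ultimately show ?thesis by linarith
qed

lemma minimal_cover_from_lines:
  assumes "latin_square n S L" "R \<subseteq> {..<n}" "C \<subseteq> {..<n}" "T \<subseteq> S" "R \<noteq> {}" "C \<noteq> {}"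
    and row: "\<And>i. i < n \<Longrightarrow> \<exists>j\<in>C. L i j \<in> T"
    and col: "\<And>j. j < n \<Longrightarrow> \<exists>i\<in>R. L i j \<in> T"
    and sym: "\<And>s. s \<in> S \<Longrightarrow> \<exists>i\<in>R. \<exists>j\<in>C. L i j = s"
  obtains K where "is_minimal_cover n S L K" "3 * n \<le> card K + card R + card C + card T"
proof -
  have S: "finite S" "card S = n"
    using assms(1) by (auto simp: latin_square_def)
  \<comment> \<open>Having two of its three lines among the chosen ones is a property of single
    entries, so it passes from \<open>E\<close> to whichever minimal cover is extracted.\<close>
  define E where "E = {(i, j, L i j) | i j. i < n \<and> j < n \<and>
    (i \<in> R \<and> j \<in> C \<or> i \<in> R \<and> L i j \<in> T \<or> j \<in> C \<and> L i j \<in> T)}"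
  have "is_cover n S L E"
    unfolding is_cover_iff
  proof (intro conjI allI impI ballI)
    show "E \<subseteq> entries n L"
      by (auto simp: E_def entries_def)
    show "\<exists>e\<in>E. fst e = i" if "i < n" for i
      using row[OF that] that assms(3) unfolding E_def by fastforce
    show "\<exists>e\<in>E. fst (snd e) = j" if "j < n" for j
      using col[OF that] that assms(2) unfolding E_def by fastforce
    show "\<exists>e\<in>E. snd (snd e) = s" if "s \<in> S" for s
      using sym[OF that] assms(2,3) unfolding E_def by fastforce
  qed
  then obtain K where K: "K \<subseteq> E" "is_minimal_cover n S L K"
    by (rule minimal_subcover)
  have "3 * n \<le> card K + card R + card C + card T"
  proof (rule card_cover_ge)
    show "is_cover n S L K"
      using K(2) by (simp add: is_minimal_cover_def)
    show "finite R" "finite C" "finite T"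
      using assms(2-4) S(1) finite_subset by blast+
    show "i \<in> R \<and> j \<in> C \<or> i \<in> R \<and> s \<in> T \<or> j \<in> C \<and> s \<in> T" if "(i, j, s) \<in> K" for i j s
      using that K(1) by (auto simp: E_def)
  qed (use S in auto)
  with K(2) that show thesis by blast
qed

section \<open>Hitting sets of lines in a Latin square\<close>

context
  fixes n :: nat and S :: "'s set" and L :: "nat \<Rightarrow> nat \<Rightarrow> 's"
  assumes latin: "latin_square n S L"
begin

lemma latin_square_symbols: "finite S" "card S = n" "\<And>i j. i < n \<Longrightarrow> j < n \<Longrightarrow> L i j \<in> S"
  using latin by (auto simp: latin_square_def)

lemma latin_square_row_inj:
  assumes "i < n" "j < n" "j' < n" "L i j = L i j'"
  shows "j = j'"
  using assms latin latin_square_symbols(3) unfolding latin_square_def by metis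

lemma latin_square_col_surj:
  assumes "j < n" "s \<in> S"
  obtains i where "i < n" "L i j = s"
  using assms latin unfolding latin_square_def by blast

lemma card_symbols_in_row:
  assumes "C \<subseteq> {..<n}" "i < n"
  shows "card (L i ` C) = card C"
  using assms by (intro card_image inj_onI) (meson latin_square_row_inj lessThan_iff subsetD)

text \<open>Every symbol of \<open>T\<close> occurs in column \<open>j\<close>, so reading off the
  symbol maps these rows onto a superset of \<open>T\<close>.\<close>

lemma card_rows_with_symbols:
  assumes "T \<subseteq> S" "j < n"
  shows "card T \<le> card {i. i < n \<and> L i j \<in> T}"
proof (rule surj_card_le)
  show "T \<subseteq> (\<lambda>i. L i j) ` {i. i < n \<and> L i j \<in> T}"
  proof
    fix s assume "s \<in> T"
    with assms latin_square_col_surj[of j s] obtain i where "i < n" "L i j = s" by blast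
    with \<open>s \<in> T\<close> show "s \<in> (\<lambda>i. L i j) ` {i. i < n \<and> L i j \<in> T}" by blast
  qed
qed simp

text \<open>Sending each column of \<open>C\<close> to the row where it carries \<open>s\<close> is
  injective, since a row contains \<open>s\<close> only once.\<close>

lemma card_rows_with_symbol_in_columns:
  assumes "C \<subseteq> {..<n}" "s \<in> S"
  shows "card C \<le> card {i. i < n \<and> (\<exists>j\<in>C. L i j = s)}"
proof -
  have "\<forall>j\<in>C. \<exists>i. i < n \<and> L i j = s"
    using assms latin_square_col_surj by (metis lessThan_iff subsetD)
  then obtain g where g: "\<And>j. j \<in> C \<Longrightarrow> g j < n \<and> L (g j) j = s"
    by metis
  show ?thesis
  proof (rule card_inj_on_le)
    show "inj_on g C"
      using g assms(1) by (intro inj_onI) (metis latin_square_row_inj lessThan_iff subsetD)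
    show "g ` C \<subseteq> {i. i < n \<and> (\<exists>j\<in>C. L i j = s)}"
      using g by blast
  qed simp
qed

lemma exists_large_minimal_cover:
  assumes "0 < n"
  obtains K where "is_minimal_cover n S L K"
    "3 * real n - (3 * sqrt n * ln n + 2 * sqrt n + 5) \<le> card K"
proof -
  \<comment> \<open>The fixed sets \<open>C\<close> and \<open>T1\<close> cost \<open>m\<close>
    lines each and every hitting set about \<open>n / m * ln n\<close>; \<open>m\<close> near
    \<open>sqrt n\<close> balances the two up to the logarithm.\<close>
  define m where "m = nat \<lceil>sqrt n\<rceil>"
  have sqrt_n: "1 \<le> sqrt n" using assms by simp
  have m: "sqrt n \<le> m" "m \<le> sqrt n + 1" "0 < m"
    using sqrt_n unfolding m_def by linarith+
  have "sqrt n \<le> real n"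
    using assms by (simp add: real_sqrt_le_iff sqrt_le_D real_le_lsqrt power2_eq_square)
  then have "m \<le> n" unfolding m_def by linarith
  have "n / m \<le> n / sqrt n"
    using m(1,3) assms by (intro divide_left_mono mult_pos_pos) auto
  then have nm: "n / m \<le> sqrt n" by (simp add: real_div_sqrt)
  have hit: "real n / m * ln n + 1 \<le> sqrt n * ln n + 1"
    using mult_right_mono[OF nm, of "ln n"] assms by simp
  obtain C where C: "C \<subseteq> {..<n}" "card C = m"
    using \<open>m \<le> n\<close> by (metis card_lessThan obtain_subset_with_card_n)
  \<comment> \<open>\<open>T2\<close> alone may be small. Adding \<open>T1\<close> guarantees
    \<open>m\<close> symbols in \<open>T\<close>, hence \<open>m\<close> candidate rows in each
    column when \<open>R1\<close> is chosen.\<close>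
  obtain T1 where T1: "T1 \<subseteq> S" "card T1 = m"
    using \<open>m \<le> n\<close> latin_square_symbols(2) by (metis obtain_subset_with_card_n)
  obtain T2 where T2: "T2 \<subseteq> S" "\<And>i. i \<in> {..<n} \<Longrightarrow> L i ` C \<inter> T2 \<noteq> {}"
    "real (card T2) \<le> card S / m * ln (card {..<n}) + 1"
    by (rule hitting_set[of S "{..<n}" m "\<lambda>i. L i ` C"])
      (use latin_square_symbols C assms m(3) in \<open>auto simp: card_symbols_in_row subset_eq\<close>)
  define T where "T = T1 \<union> T2"
  have T: "T \<subseteq> S" "m \<le> card T"
    using T1 T2 latin_square_symbols(1) finite_subset[of T2 S] finite_subset[of T1 S]
      card_mono[of T T1] unfolding T_def by auto
  obtain R1 where R1: "R1 \<subseteq> {..<n}"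
    "\<And>j. j \<in> {..<n} \<Longrightarrow> {i. i < n \<and> L i j \<in> T} \<inter> R1 \<noteq> {}"
    "real (card R1) \<le> card {..<n} / m * ln (card {..<n}) + 1"
    by (rule hitting_set[of "{..<n}" "{..<n}" m "\<lambda>j. {i. i < n \<and> L i j \<in> T}"])
      (use assms m(3) le_trans[OF T(2) card_rows_with_symbols[OF T(1)]] in auto)
  have "S \<noteq> {}" using assms latin_square_symbols by auto
  \<comment> \<open>\<open>R1\<close> ensures that the columns are covered, \<open>R2\<close> the
    symbols; enlarging either one to their union preserves both properties.\<close>
  obtain R2 where R2: "R2 \<subseteq> {..<n}"
    "\<And>s. s \<in> S \<Longrightarrow> {i. i < n \<and> (\<exists>j\<in>C. L i j = s)} \<inter> R2 \<noteq> {}"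
    "real (card R2) \<le> card {..<n} / m * ln (card S) + 1"
    by (rule hitting_set[of "{..<n}" S m "\<lambda>s. {i. i < n \<and> (\<exists>j\<in>C. L i j = s)}"])
      (use \<open>S \<noteq> {}\<close> latin_square_symbols m(3) C
        card_rows_with_symbol_in_columns[OF C(1)] in auto)
  have "C \<noteq> {}" using C m(3) by auto
  moreover have "R1 \<union> R2 \<noteq> {}" using R1(2)[of 0] assms by auto
  moreover have "\<exists>j\<in>C. L i j \<in> T" if "i < n" for i
    using T2(2)[of i] that by (auto simp: T_def)
  moreover have "\<exists>i\<in>R1 \<union> R2. L i j \<in> T" if "j < n" for j
    using R1(2)[of j] that by auto
  moreover have "\<exists>i\<in>R1 \<union> R2. \<exists>j\<in>C. L i j = s" if "s \<in> S" for s
    using R2(2)[OF that] by auto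
  ultimately obtain K where K: "is_minimal_cover n S L K"
    "3 * n \<le> card K + card (R1 \<union> R2) + card C + card T"
    using minimal_cover_from_lines[OF latin, of "R1 \<union> R2" C T] R1(1) R2(1) C(1) T(1) by blast
  have "card (R1 \<union> R2) \<le> card R1 + card R2" "card T \<le> m + card T2"
    using card_Un_le[of T1 T2] by (auto simp: T_def T1 card_Un_le)
  with K(2) C(2) have "3 * n \<le> card K + card R1 + card R2 + card T2 + 2 * m"
    by linarith
  then have "3 * real n \<le> real (card K) + card R1 + card R2 + card T2 + 2 * m"
    by linarith
  moreover have "real (card T2) \<le> sqrt n * ln n + 1" "real (card R1) \<le> sqrt n * ln n + 1"
    "real (card R2) \<le> sqrt n * ln n + 1"
    using T2(3) R1(3) R2(3) hit latin_square_symbols(2) by simp_all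
  \<comment> \<open>The constant 5 collects 1 from each of the three hitting sets and 2 from
    \<open>2 * m \<le> 2 * sqrt n + 2\<close>.\<close>
  ultimately show thesis
    using m(2) K(1) that by fastforce
qed

end

section \<open>Absorbing the logarithm into a power\<close>

theorem theorem3p8:
  fixes \<epsilon> :: real
  assumes "\<epsilon> > 0"
  shows "\<exists>C::real. \<forall>(n::nat) (S::nat set) (L::nat \<Rightarrow> nat \<Rightarrow> nat).
           latin_square n S L \<longrightarrow>
             (\<exists>K. is_minimal_cover n S L K \<and>
                  real (card K) \<ge> 3 * real n - C * real n powr (1/2 + \<epsilon>))"
proof (intro exI[of _ "3 / \<epsilon> + 7"] allI impI)
  fix n and S :: "nat set" and L
  assume latin: "latin_square n S L"
  show "\<exists>K. is_minimal_cover n S L K \<and>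
    real (card K) \<ge> 3 * real n - (3 / \<epsilon> + 7) * real n powr (1/2 + \<epsilon>)"
  proof (cases "n = 0")
    case True
    \<comment> \<open>With no lines at all, the empty set is a minimal cover.\<close>
    with latin have "is_minimal_cover n S L {}"
      by (auto simp: latin_square_def is_minimal_cover_def is_cover_iff)
    with True show ?thesis by auto
  next
    case False
    then have n: "1 \<le> real n" by simp
    let ?p = "real n powr \<epsilon>"
    have p: "1 \<le> ?p" "ln n \<le> ?p / \<epsilon>"
      using n assms ln_powr_bound[OF n assms] by (auto intro: ge_one_powr_ge_zero)
    have sqrt_n: "1 \<le> sqrt n" using n by simp
    \<comment> \<open>As \<open>sqrt n\<close> is at least 1, the terms
      \<open>2 * sqrt n + 5\<close> fit into \<open>7 * sqrt n\<close>. The bound on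
      \<open>ln n\<close> then gives \<open>3 / \<epsilon>\<close>, and \<open>?p \<ge> 1\<close>
      turns 7 into \<open>7 * ?p\<close>.\<close>
    have "3 * sqrt n * ln n + 2 * sqrt n + 5 \<le> sqrt n * (3 * ln n + 7)"
      using sqrt_n by (simp add: algebra_simps)
    also have "\<dots> \<le> sqrt n * (3 * (?p / \<epsilon>) + 7 * ?p)"
      using p sqrt_n by (intro mult_left_mono) auto
    also have "\<dots> = (3 / \<epsilon> + 7) * real n powr (1/2 + \<epsilon>)"
      using n by (simp add: powr_add powr_half_sqrt algebra_simps)
    finally have "3 * sqrt n * ln n + 2 * sqrt n + 5 \<le> \<dots>" .
    with exists_large_minimal_cover[OF latin] False show ?thesis
      by (smt (verit) neq0_conv)
  qed
qed

end
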